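(* For all $m\geq2$, as formal power series in $y$, \[ F_m(y)=\frac{1}{F_{m-1}(-y)-y} \qquad\text{and}\qquad F_m(y)=\frac{y+2F_{m-1}(y)}{2-y^2-yF_{m-1}(y)}. \]
   Context: For $n\ge1$ and $m\ge1$, let $\Omega_n(m)$ be the number of maps $g:[n]\to\{1,\dots,m\}$ with $g(j)\le g(j+1)$ for odd $j\in[n-1]$ and $g(j)\ge g(j+1)$ for even $j\in[n-1]$ (equivalently, the order polynomial of a naturally labeled zig-zag poset on $n$ elements); set $\Omega_0(m)=1$. Define $F_m(y)=\sum_{n\ge0}\Omega_n(m)y^n$. *)

theory Defs
  imports "HOL-Library.FuncSet" "HOL-Computational_Algebra.Formal_Power_Series"
begin

definition zigzag_maps :: "nat \<Rightarrow> nat \<Rightarrow> (nat \<Rightarrow> nat) set" where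
  "zigzag_maps n m =
     {g \<in> {1..n} \<rightarrow>\<^sub>E {1..m}.
        \<forall>j\<in>{1..<n}. (odd j \<longrightarrow> g j \<le> g (j + 1)) \<and> (even j \<longrightarrow> g j \<ge> g (j + 1))}"

definition zigzag_Omega :: "nat \<Rightarrow> nat \<Rightarrow> nat" where
  "zigzag_Omega n m = card (zigzag_maps n m)"

text \<open>The convention for \<open>n = 0\<close> is automatic: there is exactly one extensional
  function on the empty domain.\<close>

lemma zigzag_Omega_0: "zigzag_Omega 0 m = 1"
  by (simp add: zigzag_Omega_def zigzag_maps_def)

definition zigzag_F :: "nat \<Rightarrow> rat fps" where
  "zigzag_F m = Abs_fps (\<lambda>n. of_nat (zigzag_Omega n m))"

end

theory Submission
  imports Defs
begin

unbundle fps_syntax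

text \<open>Count the maps by their last value, reflecting \<open>{1..m}\<close> when the length is even. Appending
  a value is then the same linear step for both parities, so the resulting generating functions
  \<open>W\<^sub>1, \<dots>, W\<^sub>m\<close> are the unique solution of
  \<open>W\<^sub>k = 1 + y (W\<^sub>1 + \<dots> + W\<^sub>m\<^sub>+\<^sub>1\<^sub>-\<^sub>k)\<close>, and \<open>F\<^sub>m = W\<^sub>1\<close>. Substituting \<open>-y\<close> into the system for
  \<open>m - 1\<close> and reversing the order of its unknowns gives \<open>F\<^sub>m\<^sub>-\<^sub>1(-y) - y\<close> times the solution
  of the system for \<open>m\<close>; the first component of this is the first identity. The second one follows
  from the first and the relation \<open>2 F\<^sub>m(y) F\<^sub>m(-y) + y (F\<^sub>m(-y) - F\<^sub>m(y)) = 2\<close>, which the first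
  identity propagates from \<open>m\<close> to \<open>m + 1\<close>.\<close>

section \<open>Counting maps by their last value\<close>

definition zigzag_maps_ending :: "nat \<Rightarrow> nat \<Rightarrow> nat \<Rightarrow> (nat \<Rightarrow> nat) set" where
  "zigzag_maps_ending n m k = {g \<in> zigzag_maps n m. g n = (if odd n then k else m + 1 - k)}"

text \<open>The argument \<open>n\<close> stands for length \<open>n + 1\<close>, so the base case
  counts maps on a single point.\<close>

primrec zigzag_count :: "nat \<Rightarrow> nat \<Rightarrow> nat \<Rightarrow> nat" where
  "zigzag_count m 0 k = 1"
| "zigzag_count m (Suc n) k = (\<Sum>i=1..m+1-k. zigzag_count m n i)"

lemma finite_zigzag_maps: "finite (zigzag_maps n m)"
  by (rule finite_subset[of _ "{1..n} \<rightarrow>\<^sub>E {1..m}"]) (auto simp: zigzag_maps_def intro: finite_PiE)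

lemma finite_zigzag_maps_ending: "finite (zigzag_maps_ending n m k)"
  using finite_zigzag_maps by (simp add: zigzag_maps_ending_def)

lemma zigzag_maps_ending_disjoint:
  assumes "i \<in> {1..m}" "j \<in> {1..m}" "i \<noteq> j"
  shows "zigzag_maps_ending n m i \<inter> zigzag_maps_ending n m j = {}"
  using assms by (auto simp: zigzag_maps_ending_def split: if_splits)

lemma card_UN_zigzag_maps_ending:
  assumes "I \<subseteq> {1..m}"
  shows "card (\<Union>i\<in>I. zigzag_maps_ending n m i) = (\<Sum>i\<in>I. card (zigzag_maps_ending n m i))"
proof (rule card_UN_disjoint)
  show "finite I" using assms finite_subset by blast
  show "\<forall>i\<in>I. finite (zigzag_maps_ending n m i)" by (simp add: finite_zigzag_maps_ending)
  show "\<forall>i\<in>I. \<forall>j\<in>I. i \<noteq> j \<longrightarrow> zigzag_maps_ending n m i \<inter> zigzag_maps_ending n m j = {}"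
    using assms zigzag_maps_ending_disjoint by blast
qed

lemma zigzag_maps_value:
  assumes "g \<in> zigzag_maps n m" "j \<in> {1..n}"
  shows "g j \<in> {1..m}"
  using assms by (auto simp: zigzag_maps_def PiE_iff)

lemma zigzag_maps_eq_UN:
  assumes "n \<ge> 1"
  shows "zigzag_maps n m = (\<Union>i\<in>{1..m}. zigzag_maps_ending n m i)"
proof (intro equalityI subsetI)
  fix g assume g: "g \<in> zigzag_maps n m"
  have v: "g n \<in> {1..m}" using zigzag_maps_value[OF g, of n] assms by simp
  show "g \<in> (\<Union>i\<in>{1..m}. zigzag_maps_ending n m i)"
    \<comment> \<open>The witness undoes the reflection, recovering the index from the last
      value.\<close>
    by (rule UN_I[of "if odd n then g n else m + 1 - g n"])
      (use v g in \<open>auto simp: zigzag_maps_ending_def\<close>)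
qed (auto simp: zigzag_maps_ending_def)

lemma zigzag_maps_fun_upd:
  assumes "n \<ge> 1" "g \<in> zigzag_maps n m" "e \<in> {1..m}"
    and "if odd n then g n \<le> e else e \<le> g n"
  shows "g(Suc n := e) \<in> zigzag_maps (Suc n) m"
  using assms by (auto simp: zigzag_maps_def PiE_iff extensional_def less_Suc_eq split: if_splits)

lemma zigzag_maps_drop_last:
  assumes "g \<in> zigzag_maps (Suc n) m"
  shows "g(Suc n := undefined) \<in> zigzag_maps n m"
  using assms by (auto simp: zigzag_maps_def PiE_iff extensional_def)

text \<open>For odd \<open>n\<close> the new order condition reads \<open>i \<le> m + 1 - k\<close>;
  for even \<open>n\<close> it reads \<open>m + 1 - i \<ge> k\<close>, which is the same restriction
  on \<open>i\<close>.\<close>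

lemma card_zigzag_maps_ending_Suc:
  assumes n: "n \<ge> 1" and k: "k \<in> {1..m}"
  shows "card (zigzag_maps_ending (Suc n) m k) = (\<Sum>i=1..m+1-k. card (zigzag_maps_ending n m i))"
proof -
  define e where "e = (if odd (Suc n) then k else m + 1 - k)"
  let ?U = "\<Union>i\<in>{1..m+1-k}. zigzag_maps_ending n m i"
  have e: "e \<in> {1..m}" using k by (auto simp: e_def)
  have "bij_betw (\<lambda>g. g(Suc n := e)) ?U (zigzag_maps_ending (Suc n) m k)"
  \<comment> \<open>Dropping the last value means resetting it to \<open>undefined\<close>, as the
    maps are extensional.\<close>
  proof (rule bij_betw_byWitness[where f' = "\<lambda>g. g(Suc n := undefined)"])
    show "\<forall>g\<in>?U. (g(Suc n := e))(Suc n := undefined) = g"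
      by (auto simp: zigzag_maps_ending_def zigzag_maps_def PiE_iff extensional_def fun_eq_iff)
    show "\<forall>g\<in>zigzag_maps_ending (Suc n) m k. (g(Suc n := undefined))(Suc n := e) = g"
      by (auto simp: zigzag_maps_ending_def e_def fun_eq_iff)
    show "(\<lambda>g. g(Suc n := e)) ` ?U \<subseteq> zigzag_maps_ending (Suc n) m k"
    proof safe
      fix g i assume i: "i \<in> {1..m+1-k}" and g: "g \<in> zigzag_maps_ending n m i"
      have "g(Suc n := e) \<in> zigzag_maps (Suc n) m"
        by (rule zigzag_maps_fun_upd[OF n _ e])
          (use i g k in \<open>auto simp: zigzag_maps_ending_def e_def\<close>)
      then show "g(Suc n := e) \<in> zigzag_maps_ending (Suc n) m k"
        by (simp add: zigzag_maps_ending_def e_def)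
    qed
    show "(\<lambda>g. g(Suc n := undefined)) ` zigzag_maps_ending (Suc n) m k \<subseteq> ?U"
    proof (intro image_subsetI)
      fix g assume g: "g \<in> zigzag_maps_ending (Suc n) m k"
      then have gz: "g \<in> zigzag_maps (Suc n) m" and ge: "g (Suc n) = e"
        by (simp_all add: zigzag_maps_ending_def e_def)
      have v: "g n \<in> {1..m}" using zigzag_maps_value[OF gz, of n] n by simp
      have step: "if odd n then g n \<le> e else e \<le> g n"
        using gz n ge by (auto simp: zigzag_maps_def)
      show "g(Suc n := undefined) \<in> ?U"
        by (rule UN_I[of "if odd n then g n else m + 1 - g n"])
          (use v step k zigzag_maps_drop_last[OF gz] in
            \<open>auto simp: zigzag_maps_ending_def e_def split: if_splits\<close>)
    qed
  qed
  then have "card (zigzag_maps_ending (Suc n) m k) = card ?U"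
    by (simp add: bij_betw_same_card)
  also have "\<dots> = (\<Sum>i=1..m+1-k. card (zigzag_maps_ending n m i))"
    by (rule card_UN_zigzag_maps_ending) (use k in auto)
  finally show ?thesis .
qed

lemma card_zigzag_maps_ending_1:
  assumes "k \<in> {1..m}"
  shows "card (zigzag_maps_ending 1 m k) = 1"
proof -
  have "zigzag_maps_ending 1 m k = {(\<lambda>_. undefined)(1 := k)}"
    using assms
    by (auto simp: zigzag_maps_ending_def zigzag_maps_def PiE_iff extensional_def fun_eq_iff)
  then show ?thesis by simp
qed

lemma card_zigzag_maps_ending:
  assumes "k \<in> {1..m}"
  shows "card (zigzag_maps_ending (Suc n) m k) = zigzag_count m n k"
  using assms
proof (induction n arbitrary: k)
  case 0
  then show ?case using card_zigzag_maps_ending_1 by simp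
next
  case (Suc n)
  have "card (zigzag_maps_ending (Suc (Suc n)) m k)
      = (\<Sum>i=1..m+1-k. card (zigzag_maps_ending (Suc n) m i))"
    using Suc.prems by (intro card_zigzag_maps_ending_Suc) auto
  also have "\<dots> = (\<Sum>i=1..m+1-k. zigzag_count m n i)"
    by (intro sum.cong refl Suc.IH) (use Suc.prems in auto)
  finally show ?case by simp
qed

text \<open>Index \<open>1\<close> is an extreme last value that restricts nothing before it, so for
  \<open>n \<ge> 1\<close> the recursion at \<open>k = 1\<close> sums over all maps of length
  \<open>n\<close>.\<close>

lemma zigzag_Omega_eq_count: "zigzag_Omega n m = zigzag_count m n 1"
proof (cases n)
  case 0
  then show ?thesis by (simp add: zigzag_Omega_0)
next
  case (Suc l)
  have "zigzag_Omega n m = card (\<Union>i\<in>{1..m}. zigzag_maps_ending n m i)"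
    using zigzag_maps_eq_UN[of n m] Suc by (simp add: zigzag_Omega_def)
  also have "\<dots> = (\<Sum>i=1..m. card (zigzag_maps_ending n m i))"
    by (rule card_UN_zigzag_maps_ending) simp
  also have "\<dots> = (\<Sum>i=1..m. zigzag_count m l i)"
    by (intro sum.cong refl) (simp add: Suc card_zigzag_maps_ending)
  finally show ?thesis by (simp add: Suc)
qed

section \<open>The linear system for the generating functions\<close>

definition zigzag_W :: "nat \<Rightarrow> nat \<Rightarrow> rat fps" where
  "zigzag_W m k = Abs_fps (\<lambda>n. of_nat (zigzag_count m n k))"

lemma zigzag_F_eq_W: "zigzag_F m = zigzag_W m 1"
  by (simp add: zigzag_F_def zigzag_W_def zigzag_Omega_eq_count)

lemma zigzag_W_eq: "zigzag_W m k = 1 + fps_X * (\<Sum>i=1..m+1-k. zigzag_W m i)"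
proof (rule fps_ext)
  fix n
  show "zigzag_W m k $ n = (1 + fps_X * (\<Sum>i=1..m+1-k. zigzag_W m i)) $ n"
    by (cases n) (simp_all add: zigzag_W_def fps_sum_nth)
qed

text \<open>The factor \<open>fps_X\<close> makes each coefficient depend only on \<open>c\<close>
  and on the previous coefficients of unknowns with index still in \<open>{1..m}\<close>.\<close>

lemma zigzag_system_unique:
  fixes f g :: "nat \<Rightarrow> 'a::comm_ring_1 fps"
  assumes f: "\<And>k. k \<in> {1..m} \<Longrightarrow> f k = c + fps_X * (\<Sum>i=1..m+1-k. f i)"
    and g: "\<And>k. k \<in> {1..m} \<Longrightarrow> g k = c + fps_X * (\<Sum>i=1..m+1-k. g i)"
    and k: "k \<in> {1..m}"
  shows "f k = g k"
proof -
  have "f k $ n = g k $ n" for n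
    using k
  proof (induction n arbitrary: k)
    case 0
    then show ?case by (subst f[OF 0], subst g[OF 0]) simp
  next
    case (Suc n)
    have "(\<Sum>i=1..m+1-k. f i $ n) = (\<Sum>i=1..m+1-k. g i $ n)"
      by (intro sum.cong refl Suc.IH) (use Suc.prems in auto)
    then show ?case
      by (subst f[OF Suc.prems], subst g[OF Suc.prems]) (simp add: fps_sum_nth)
  qed
  then show ?thesis by (simp add: fps_eq_iff)
qed

lemma zigzag_F_Suc_mult:
  "zigzag_F (Suc m) * (fps_compose (zigzag_F m) (- fps_X) - fps_X) = 1"
proof -
  define H where "H k = fps_compose (zigzag_W m k) (- fps_X)" for k
  define D where "D = H 1 - fps_X"
  have H: "H k = 1 - fps_X * (\<Sum>i=1..m+1-k. H i)" for k
    unfolding H_def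
    by (subst zigzag_W_eq)
      (simp add: fps_compose_add_distrib fps_compose_mult_distrib fps_compose_sum_distrib)
  have H_last: "H (Suc m) = 1" by (subst H) simp
  \<comment> \<open>The term \<open>- fps_X\<close> supplies the missing summand, since
    \<open>H (Suc m) = 1\<close>.\<close>
  have D_eq: "D = 1 - fps_X * (\<Sum>i=1..Suc m. H i)"
    unfolding D_def by (subst H) (simp add: H_last algebra_simps)
  \<comment> \<open>Component \<open>k = 1\<close> of the equality of two solutions with constant
    \<open>D\<close>: the reversed \<open>H\<close> and \<open>D\<close> times
    \<open>zigzag_W (Suc m)\<close>.\<close>
  have "H (m + 2 - 1) = D * zigzag_W (Suc m) 1"
  proof (rule zigzag_system_unique[where m = "Suc m" and c = D])
    fix k assume k: "k \<in> {1..Suc m}"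
    have reindex: "(\<Sum>i=1..Suc m+1-k. H (m + 2 - i)) = (\<Sum>i=k..Suc m. H i)"
      by (rule sum.reindex_bij_witness[where i = "\<lambda>i. m + 2 - i" and j = "\<lambda>i. m + 2 - i"])
        (use k in auto)
    \<comment> \<open>The first upper bound is \<open>k - 1\<close>. Taking the full sum into
      \<open>D\<close> turns the subtracted initial segment into an added tail.\<close>
    have split: "(\<Sum>i=1..Suc m. H i) = (\<Sum>i=1..m+1-(m+2-k). H i) + (\<Sum>i=k..Suc m. H i)"
    proof -
      have "{1..Suc m} = {1..m+1-(m+2-k)} \<union> {k..Suc m}" using k by auto
      then show ?thesis
        using k by (simp only:) (intro sum.union_disjoint; auto)
    qed
    show "H (m + 2 - k) = D + fps_X * (\<Sum>i=1..Suc m+1-k. H (m + 2 - i))"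
      unfolding D_eq by (subst H) (simp only: reindex split ring_distribs, simp)
  next
    fix k
    show "D * zigzag_W (Suc m) k = D + fps_X * (\<Sum>i=1..Suc m+1-k. D * zigzag_W (Suc m) i)"
      by (subst zigzag_W_eq) (simp add: algebra_simps sum_distrib_left)
  qed simp
  then have "D * zigzag_W (Suc m) 1 = 1" by (simp add: H_last)
  then show ?thesis
    by (simp add: D_def H_def zigzag_F_eq_W mult.commute)
qed

section \<open>The relation between a series and its reflection\<close>

lemma zigzag_F_reflect_Suc_mult:
  "fps_compose (zigzag_F (Suc m)) (- fps_X) * (zigzag_F m + fps_X) = 1"
proof -
  have "fps_compose (zigzag_F (Suc m) * (fps_compose (zigzag_F m) (- fps_X) - fps_X)) (- fps_X) = 1"
    by (simp add: zigzag_F_Suc_mult)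
  moreover have "fps_compose (fps_compose (zigzag_F m) (- fps_X)) (- fps_X) = zigzag_F m"
    by (simp add: fps_compose_assoc[symmetric] fps_compose_uminus)
  ultimately show ?thesis
    by (simp add: fps_compose_mult_distrib fps_compose_sub_distrib)
qed

lemma zigzag_F_0: "zigzag_F 0 = 1"
  using zigzag_W_eq[of 0 1] by (simp add: zigzag_F_eq_W)

text \<open>This serves to eliminate the reflected series from the first identity. The induction
  starts at \<open>m = 0\<close>, where both series are \<open>1\<close>.\<close>

lemma zigzag_F_reflect_relation:
  "2 * zigzag_F m * fps_compose (zigzag_F m) (- fps_X)
     + fps_X * (fps_compose (zigzag_F m) (- fps_X) - zigzag_F m) = 2"
proof (induction m)
  case 0
  then show ?case by (simp add: zigzag_F_0)
next
  case (Suc m)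
  define h H f F where "h = zigzag_F m" and "H = fps_compose (zigzag_F m) (- fps_X)"
    and "f = zigzag_F (Suc m)" and "F = fps_compose (zigzag_F (Suc m)) (- fps_X)"
  have 1: "f * (H - fps_X) = 1" and 2: "F * (h + fps_X) = 1" and IH: "2 * h * H + fps_X * (H - h) = 2"
    using zigzag_F_Suc_mult[of m] zigzag_F_reflect_Suc_mult[of m] Suc.IH
    by (simp_all add: h_def H_def f_def F_def)
  \<comment> \<open>Multiplying by the units \<open>H - fps_X\<close> and \<open>h + fps_X\<close>,
    the inverses of \<open>f\<close> and \<open>F\<close>, turns this into
    \<open>IH\<close>.\<close>
  have "2 * f * F + fps_X * (F - f) = 2" using 1 2 IH by algebra
  then show ?case by (simp add: f_def F_def)
qed

theorem theorem3p15:
  fixes m :: nat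
  assumes "m \<ge> 2"
  shows "zigzag_F m = 1 / (fps_compose (zigzag_F (m - 1)) (- fps_X) - fps_X)
       \<and> zigzag_F m = (fps_X + 2 * zigzag_F (m - 1))
                        / (2 - fps_X ^ 2 - fps_X * zigzag_F (m - 1))"
proof -
  define h H where "h = zigzag_F (m - 1)" and "H = fps_compose (zigzag_F (m - 1)) (- fps_X)"
  have 1: "zigzag_F m * (H - fps_X) = 1"
    using zigzag_F_Suc_mult[of "m - 1"] assms by (simp add: H_def)
  have rel: "2 * h * H + fps_X * (H - h) = 2"
    using zigzag_F_reflect_relation[of "m - 1"] by (simp add: h_def H_def)
  \<comment> \<open>Multiply \<open>1\<close> by \<open>2 * h + fps_X\<close> and use
    \<open>rel\<close> in the form \<open>H * (2 * h + fps_X) = 2 + fps_X * h\<close>.\<close>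
  have 2: "zigzag_F m * (2 - fps_X ^ 2 - fps_X * h) = fps_X + 2 * h"
    using 1 rel by algebra
  have nz1: "H - fps_X \<noteq> 0" using 1 by auto
  have "(2 - fps_X ^ 2 - fps_X * h) $ 0 = 2" by (simp add: fps_numeral_nth_0)
  then have nz2: "2 - fps_X ^ 2 - fps_X * h \<noteq> 0" by (metis fps_zero_nth zero_neq_numeral)
  have "zigzag_F m = 1 / (H - fps_X)"
    using nonzero_mult_div_cancel_right[OF nz1, of "zigzag_F m"] 1 by simp
  moreover have "zigzag_F m = (fps_X + 2 * h) / (2 - fps_X ^ 2 - fps_X * h)"
    using nonzero_mult_div_cancel_right[OF nz2, of "zigzag_F m"] 2 by simp
  ultimately show ?thesis by (simp add: h_def H_def)
qed

end
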